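(* Let $A,B,C_1,\dots,C_m\in\mathbb{C}^{n\times n}$, $r_i,s_i\in\mathbb{C}^n$ and $g_i\in\mathbb{C}^n\setminus\{0\}$ for $i=1,\dots,m$, and put $f_i(x)=\frac{r_i^Tx}{s_i^Tx}$. Assume $(\lambda,\mu_1,\dots,\mu_m,x_1,\dots,x_{m+1})$ is a solution of the multiparameter eigenvalue problem $$\begin{aligned}-Ax_1&=(\lambda B+\mu_1C_1+\cdots+\mu_mC_m)x_1,\\ -(A+g_jr_j^T)x_{j+1}&=\bigl(\lambda B+\mu_1C_1+\cdots+\mu_mC_m-\mu_jg_js_j^T\bigr)x_{j+1},\qquad j=1,\dots,m.\end{aligned}$$ If $x_1=x_2=\cdots=x_{m+1}=x$ and $s_j^Tx\neq0$ for all $j=1,\dots,m$, then $(\lambda,x)$ is a solution of the NEPv $$(A+\lambda B+f_1(x)C_1+\cdots+f_m(x)C_m)x=0.$$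
   Context: A solution of the NEPv is a pair $(\lambda,x)$ with $\lambda\in\mathbb{C}$, $x\in\mathbb{C}^n\setminus\{0\}$ and $s_i^Tx\ne0$ for all $i$ satisfying the NEPv equation. A solution of the multiparameter eigenvalue problem is a tuple $(\lambda,\mu_1,\dots,\mu_m,x_1,\dots,x_{m+1})$ with $\lambda,\mu_i\in\mathbb{C}$ and all $x_i\in\mathbb{C}^n$ nonzero that satisfies all $m+1$ equations. The superscript $T$ denotes transpose without conjugation. *)

theory Defs
  imports "HOL-Analysis.Analysis"
begin

text \<open>
  Throughout, \<open>'n\<close> indexes the coordinates of \<open>\<complex>\<^sup>n\<close>. A family indexed by \<open>1, \<dots>, m\<close>
  is a function on \<open>nat\<close> of which only the values on \<open>{1..m}\<close> are used. The bilinear form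
  \<open>u\<^sup>T v\<close> (no conjugation) is the library's \<open>scalar_product u v\<close>; the inner
  product \<open>(\<bullet>)\<close> on \<open>complex ^ 'n\<close> is real-valued and would be wrong here.
\<close>

definition mat_scale :: "complex \<Rightarrow> complex ^ 'n ^ 'n \<Rightarrow> complex ^ 'n ^ 'n" (infixr \<open>*\<^sub>m\<close> 75)
  where "c *\<^sub>m M = map_matrix (\<lambda>z. c * z) M"

text \<open>The rank-one matrix \<open>u v\<^sup>T\<close>, again without conjugation.\<close>

definition outer_prod :: "complex ^ 'n \<Rightarrow> complex ^ 'n \<Rightarrow> complex ^ 'n ^ 'n"
  where "outer_prod u v = (\<chi> i j. u $ i * v $ j)"

definition linear_ratio :: "complex ^ 'n \<Rightarrow> complex ^ 'n \<Rightarrow> complex ^ 'n \<Rightarrow> complex"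
  where "linear_ratio r s x = scalar_product r x / scalar_product s x"

text \<open>
  Solutions of \<open>(A + \<lambda> B + f\<^sub>1(x) C\<^sub>1 + \<dots> + f\<^sub>m(x) C\<^sub>m) x = 0\<close> with
  \<open>f\<^sub>i(x) = (r\<^sub>i\<^sup>T x) / (s\<^sub>i\<^sup>T x)\<close>. The condition \<open>s\<^sub>i\<^sup>T x \<noteq> 0\<close> rules out the
  convention \<open>z / 0 = 0\<close>.
\<close>

definition nepv_solution ::
  "nat \<Rightarrow> complex ^ 'n ^ 'n \<Rightarrow> complex ^ 'n ^ 'n \<Rightarrow> (nat \<Rightarrow> complex ^ 'n ^ 'n) \<Rightarrow>
   (nat \<Rightarrow> complex ^ 'n) \<Rightarrow> (nat \<Rightarrow> complex ^ 'n) \<Rightarrow> complex \<Rightarrow> complex ^ 'n \<Rightarrow> bool"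
  where "nepv_solution m A B C r s l x \<longleftrightarrow>
    x \<noteq> 0 \<and> (\<forall>i\<in>{1..m}. scalar_product (s i) x \<noteq> 0) \<and>
    (A + l *\<^sub>m B + (\<Sum>i=1..m. linear_ratio (r i) (s i) x *\<^sub>m C i)) *v x = 0"

text \<open>
  Solutions \<open>(\<lambda>, \<mu>\<^sub>1, \<dots>, \<mu>\<^sub>m, x\<^sub>1, \<dots>, x\<^sub>m\<^sub>+\<^sub>1)\<close> of the multiparameter eigenvalue problem
  given by the matrices \<open>A\<close>, \<open>B\<close>, \<open>C\<^sub>i\<close> and the rank-one updates \<open>g\<^sub>j r\<^sub>j\<^sup>T\<close>, \<open>g\<^sub>j s\<^sub>j\<^sup>T\<close>.
\<close>

definition mep_solution ::
  "nat \<Rightarrow> complex ^ 'n ^ 'n \<Rightarrow> complex ^ 'n ^ 'n \<Rightarrow> (nat \<Rightarrow> complex ^ 'n ^ 'n) \<Rightarrow>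
   (nat \<Rightarrow> complex ^ 'n) \<Rightarrow> (nat \<Rightarrow> complex ^ 'n) \<Rightarrow> (nat \<Rightarrow> complex ^ 'n) \<Rightarrow>
   complex \<Rightarrow> (nat \<Rightarrow> complex) \<Rightarrow> (nat \<Rightarrow> complex ^ 'n) \<Rightarrow> bool"
  where "mep_solution m A B C r s g l \<mu> X \<longleftrightarrow>
    (\<forall>k\<in>{1..m+1}. X k \<noteq> 0) \<and>
    (- A) *v X 1 = (l *\<^sub>m B + (\<Sum>i=1..m. \<mu> i *\<^sub>m C i)) *v X 1 \<and>
    (\<forall>j\<in>{1..m}.
      (- (A + outer_prod (g j) (r j))) *v X (j+1) =
        (l *\<^sub>m B + (\<Sum>i=1..m. \<mu> i *\<^sub>m C i) - \<mu> j *\<^sub>m outer_prod (g j) (s j)) *v X (j+1))"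

end

theory Submission
  imports Defs
begin

text \<open>
  The first equation and the \<open>(j+1)\<close>-st one differ only by rank-one terms. At a common
  eigenvector \<open>x\<close> they may be subtracted, and what is left is
  \<open>(r\<^sub>j\<^sup>T x) g\<^sub>j = \<mu>\<^sub>j (s\<^sub>j\<^sup>T x) g\<^sub>j\<close>: the image of a rank-one matrix \<open>g v\<^sup>T\<close> is spanned
  by \<open>g\<close> (\<open>outer_prod_mult_vec\<close>). Since \<open>g\<^sub>j \<noteq> 0\<close> and \<open>s\<^sub>j\<^sup>T x \<noteq> 0\<close>, the auxiliary
  eigenvalue \<open>\<mu>\<^sub>j\<close> is forced to be the ratio \<open>f\<^sub>j(x)\<close>
  (\<open>eigenvalue_eq_linear_ratio\<close>). With these values the first equation is the nonlinear
  eigenvalue equation.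
\<close>

lemma mat_scale_mult_vec: "(c *\<^sub>m M) *v x = c *s (M *v x)"
  by (simp add: mat_scale_def map_matrix_def matrix_vector_mult_def vec_eq_iff
      sum_distrib_left mult.assoc)

lemma outer_prod_mult_vec: "outer_prod u v *v x = scalar_product v x *s u"
  by (simp add: outer_prod_def scalar_product_def matrix_vector_mult_def vec_eq_iff
      sum_distrib_left mult_ac)

lemma uminus_mult_vec: "(- M) *v x = - (M *v x)" for M :: "'a::ring_1 ^ 'n ^ 'm"
  using matrix_vector_mult_diff_rdistrib[of 0 M x] by simp

text \<open>
  Here \<open>M\<close> stands for the matrix pencil that all equations of the multiparameter problem
  share.
\<close>

lemma eigenvalue_eq_linear_ratio:
  assumes "g \<noteq> 0" and "scalar_product s x \<noteq> 0"
    and base: "(- A) *v x = M *v x"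
    and update: "(- (A + outer_prod g r)) *v x = (M - c *\<^sub>m outer_prod g s) *v x"
  shows "c = linear_ratio r s x"
proof -
  have "- (A *v x) - scalar_product r x *s g = M *v x - (c * scalar_product s x) *s g"
    using update
    by (simp add: uminus_mult_vec matrix_vector_mult_add_rdistrib
        matrix_vector_mult_diff_rdistrib mat_scale_mult_vec outer_prod_mult_vec)
  then have "scalar_product r x *s g = (c * scalar_product s x) *s g"
    using base by (simp add: uminus_mult_vec)
  then have "scalar_product r x = c * scalar_product s x"
    using \<open>g \<noteq> 0\<close> by (simp add: vector_mul_rcancel)
  then show ?thesis
    using assms(2) by (simp add: linear_ratio_def)
qed

theorem theorem3p3:
  fixes A B :: "complex ^ 'n ^ 'n" and C :: "nat \<Rightarrow> complex ^ 'n ^ 'n"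
    and r s g X :: "nat \<Rightarrow> complex ^ 'n" and x :: "complex ^ 'n"
    and l :: complex and \<mu> :: "nat \<Rightarrow> complex" and m :: nat
  assumes "\<And>i. i \<in> {1..m} \<Longrightarrow> g i \<noteq> 0"
    and "mep_solution m A B C r s g l \<mu> X"
    and "\<And>k. k \<in> {1..m+1} \<Longrightarrow> X k = x"
    and "\<And>j. j \<in> {1..m} \<Longrightarrow> scalar_product (s j) x \<noteq> 0"
  shows "nepv_solution m A B C r s l x"
proof -
  define M where "M = l *\<^sub>m B + (\<Sum>i=1..m. \<mu> i *\<^sub>m C i)"
  have XS: "X (j+1) = x" if "j \<in> {1..m}" for j
    using assms(3) that by auto
  have X1: "X 1 = x"
    using assms(3) by simp
  have "x \<noteq> 0" and base: "(- A) *v x = M *v x"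
    using assms(2) X1 by (auto simp: mep_solution_def M_def)
  have "\<mu> j = linear_ratio (r j) (s j) x" if j: "j \<in> {1..m}" for j
  proof (rule eigenvalue_eq_linear_ratio[OF assms(1)[OF j] assms(4)[OF j] base])
    show "(- (A + outer_prod (g j) (r j))) *v x = (M - \<mu> j *\<^sub>m outer_prod (g j) (s j)) *v x"
      using assms(2) j XS[OF j] by (auto simp: mep_solution_def M_def)
  qed
  then have M_ratio: "M = l *\<^sub>m B + (\<Sum>i=1..m. linear_ratio (r i) (s i) x *\<^sub>m C i)"
    by (simp add: M_def)
  have "(A + M) *v x = 0"
    by (simp add: uminus_mult_vec matrix_vector_mult_add_rdistrib flip: base)
  then show ?thesis
    using \<open>x \<noteq> 0\<close> assms(4) by (simp add: nepv_solution_def M_ratio add.assoc)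
qed

end
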